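(* Let $p,q\in\mathbb{Z}$ with $\min\{p+q+1,\,p-q\}\geq 0$. Then \[ \frac{8(-1)^q}{3^{3q+\frac{5}{2}}\,\pi}=\Big(\frac{1}{2}\Big)_{p+2q+2} \sum_{k=0}^{\infty}\frac{(\frac{5}{2})_{k+3p}(\frac{5}{2})_{k+3q}(-\frac{3}{2})_{2k-3q}} {k!\,(k+p-q)!\,(2k+3p+3q+4)!}\cdot\frac{8k+6p+5}{9^k}. \]
   Context: For a complex number $x$ and an integer $n$ (possibly negative), the shifted factorial is defined by $(x)_n=\Gamma(x+n)/\Gamma(x)$, where $\Gamma$ is the Gamma function. *)

theory Defs
  imports "HOL-Analysis.Analysis"
begin

text \<open>
  Unlike \<^const>\<open>pochhammer\<close>, the index is an integer and may be negative. If \<open>x\<close> is not an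
  integer, neither \<open>x\<close> nor \<open>x + n\<close> is a pole of \<^const>\<open>Gamma\<close>, and \<^term>\<open>Gamma (x::complex)\<close>
  is nonzero, so the quotient has its usual meaning.
\<close>
definition shifted_factorial :: "complex \<Rightarrow> int \<Rightarrow> complex" where
  "shifted_factorial x n = Gamma (x + of_int n) / Gamma x"

text \<open>
  The arguments of \<^const>\<open>nat\<close> are nonnegative for all \<open>k\<close> whenever
  \<open>p + q + 1 \<ge> 0\<close> and \<open>p - q \<ge> 0\<close>, since \<open>2k + 3p + 3q + 4 = 2k + 3(p + q + 1) + 1\<close>.
\<close>
definition series_term :: "int \<Rightarrow> int \<Rightarrow> nat \<Rightarrow> complex" where
  "series_term p q k =
     (shifted_factorial (5/2) (int k + 3*p) * shifted_factorial (5/2) (int k + 3*q)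
        * shifted_factorial (-(3/2)) (2 * int k - 3*q))
     / (fact k * fact (nat (int k + p - q)) * fact (nat (2 * int k + 3*p + 3*q + 4)))
     * (of_int (8 * int k + 6*p + 5) / 9 ^ k)"

end

(*
  With a = 5/2 + 3p and b = 5/2 + 3q the series is, up to a constant factor, the sum S(a) over k of
    u(a,k) = (a + 4k) (a)_k (b)_k (1-b)_{2k} / (k! (1 + (a-b)/3)_k (a+b)_{2k} 9^k).
  A Wilf-Zeilberger pair gives S(a) = R(a) S(a+3) with an explicit rational R.  After iteration the
  shift parameter tends to infinity, where only the term k = 0 survives, so S(a + 3n) / (a + 3n) -> 1,
  and the product of the factors R(a + 3j) is evaluated by Euler's limit for 1/Gamma.  The reflection
  formula for Gamma b Gamma (1 - b) then produces pi and the sign.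
*)
theory Submission
  imports Defs "HOL-Real_Asymp.Real_Asymp"
begin

section \<open>The summand and its rational term ratios\<close>

text \<open>Normalised to the value \<open>a\<close> at \<open>k = 0\<close>. Passing from
  \<open>a\<close> to \<open>a + 3\<close> raises the lower parameter \<open>1 + (a - b) / 3\<close>
  by exactly 1, so the shifted and unshifted terms have a rational quotient.\<close>

definition cubic_term :: "real \<Rightarrow> real \<Rightarrow> nat \<Rightarrow> real" where
  "cubic_term a b k =
     (a + 4 * real k) * pochhammer a k * pochhammer b k * pochhammer (1 - b) (2 * k)
     / (fact k * pochhammer (1 + (a - b) / 3) k * pochhammer (a + b) (2 * k) * 9 ^ k)"

text \<open>The rational factor is the certificate found by Gosper's algorithm.\<close>
definition cubic_cert :: "real \<Rightarrow> real \<Rightarrow> nat \<Rightarrow> real" where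
  "cubic_cert a b k =
     real k * (9 * real k + 6 * a + 3 * b) / ((a + b + 2 * real k) * (a + 4 * real k))
     * cubic_term a b k"

text \<open>The factor R(a) of the recurrence. Blocks of three factors are kept as Pochhammer
  symbols so that the product over \<open>a\<close>, \<open>a + 3\<close>, \<open>a + 6\<close>, ...
  collapses into longer ones.\<close>

definition cubic_shift :: "real \<Rightarrow> real \<Rightarrow> real" where
  "cubic_shift a b = (a + 2 * b) / 3 * pochhammer a 3 / ((1 + (a - b) / 3) * pochhammer (a + b) 3)"

lemma cubic_term_Suc:
  fixes a b :: real
  assumes "a > 0" "b \<le> a" "a + b > 0"
  shows "cubic_term a b (Suc k) =
    (a + 4 * real k + 4) * (a + real k) * (b + real k) * (1 - b + 2 * real k) * (2 - b + 2 * real k)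
    / (9 * (a + 4 * real k) * (1 + real k) * (1 + (a - b) / 3 + real k) * (a + b + 2 * real k) * (a + b + 2 * real k + 1))
    * cubic_term a b k"
proof -
  define d where "d = 1 + (a - b) / 3"
  have d: "d > 0" using assms by (simp add: d_def add_pos_nonneg)
  have D: "pochhammer d k > 0" "pochhammer (a + b) (2 * k) > 0"
    using assms d by (auto intro!: pochhammer_pos)
  have dbl: "pochhammer x (2 * Suc k) = pochhammer x (2 * k) * (x + 2 * real k) * (x + 2 * real k + 1)" for x :: real
    by (simp add: pochhammer_Suc algebra_simps)
  have pos: "a + 4 * real k > 0" "d + real k > 0" "a + b + 2 * real k > 0" "a + b + 2 * real k + 1 > 0"
    using assms d by auto
  show ?thesis
    unfolding cubic_term_def d_def[symmetric] dbl pochhammer_Suc[of _ k] fact_Suc power_Suc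
    using D pos by (simp add: divide_simps) (simp add: algebra_simps)
qed

text \<open>Both sides split the same product of \<open>n + 3\<close> factors, once after three
  factors and once after \<open>n\<close>.\<close>

lemma pochhammer_shift3:
  fixes x :: real
  shows "pochhammer x 3 * pochhammer (x + 3) n = pochhammer x n * pochhammer (x + real n) 3"
  using pochhammer_product'[of x 3 n] pochhammer_product'[of x n 3] by (simp add: add.commute)

lemma pochhammer_3:
  fixes x :: real
  shows "pochhammer x 3 = x * (x + 1) * (x + 2)"
  by (simp add: numeral_3_eq_3 pochhammer_Suc)

lemma cubic_term_shift:
  fixes a b :: real
  assumes "a > 0" "b \<le> a" "a + b > 0"
  shows "cubic_term (a + 3) b k =
    (a + 3 + 4 * real k) / (a + 4 * real k) * (pochhammer (a + real k) 3 / pochhammer a 3)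
    * (pochhammer (a + b) 3 / pochhammer (a + b + 2 * real k) 3)
    * ((1 + (a - b) / 3) / (1 + (a - b) / 3 + real k)) * cubic_term a b k"
proof -
  define d where "d = 1 + (a - b) / 3"
  have d: "d > 0" using assms by (simp add: d_def add_pos_nonneg)
  have d1: "1 + (a + 3 - b) / 3 = d + 1" by (simp add: d_def)
  have D: "pochhammer d k > 0" "pochhammer (a + b) (2 * k) > 0" "pochhammer (a + b) 3 > 0"
    "pochhammer a 3 > 0" "pochhammer (a + b + 2 * real k) 3 > 0" "a + 4 * real k > 0" "d + real k > 0"
    using assms d by (auto intro!: pochhammer_pos)
  have 1: "pochhammer (a + 3) k = pochhammer a k * pochhammer (a + real k) 3 / pochhammer a 3"
    using pochhammer_shift3[of a k] D by (simp add: field_simps)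
  have 2: "pochhammer (a + b + 3) (2 * k)
      = pochhammer (a + b) (2 * k) * pochhammer (a + b + 2 * real k) 3 / pochhammer (a + b) 3"
    using pochhammer_shift3[of "a + b" "2 * k"] D by (simp add: field_simps)
  have 3: "pochhammer (d + 1) k = pochhammer d k * (d + real k) / d"
    using pochhammer_rec[of d k] pochhammer_Suc[of d k] d by (simp add: field_simps)
  have 4: "a + 3 + b = a + b + 3" by simp
  show ?thesis
    unfolding cubic_term_def d_def[symmetric] d1 4 1 2 3
    using D d by (simp add: divide_simps)
qed

section \<open>The Wilf-Zeilberger pair\<close>

text \<open>This is the Wilf-Zeilberger equation with denominators cleared: dividing by
  \<open>(d + x) * (e + 2 * x) * (e + 2 * x + 1) * (e + 2 * x + 2)\<close> and restoring the common
  factor of the terms gives \<open>cubic_wz\<close>, with \<open>x\<close> in the role of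
  \<open>k\<close>.\<close>

lemma cubic_cert_identity:
  fixes a b x :: real
  defines "d \<equiv> 1 + (a - b) / 3" and "e \<equiv> a + b"
  shows "(a + 2 * b) / 3 * (a + x) * (a + x + 1) * (a + x + 2) * (a + 3 + 4 * x)
      - (a + 4 * x) * ((d + x) * (e + 2 * x) * (e + 2 * x + 1) * (e + 2 * x + 2))
    = (a + x) * (b + x) * (1 - b + 2 * x) * (2 - b + 2 * x) * (9 * (x + 1) + 6 * a + 3 * b) / 9
      - x * (d + x) * (e + 2 * x + 1) * (e + 2 * x + 2) * (9 * x + 6 * a + 3 * b)"
    (is "?l = ?r")
proof -
  \<comment> \<open>Eliminating \<open>b\<close> rather than \<open>d\<close> leaves a polynomial
    identity in \<open>a\<close>, \<open>d\<close>, \<open>x\<close>; the factor 9 below clears the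
    numerical denominators.\<close>
  have b: "b = a + 3 - 3 * d" by (simp add: d_def field_simps)
  have e: "e = 2 * a + 3 - 3 * d" by (simp add: e_def b)
  have "9 * ?l = 9 * ?r"
    unfolding e unfolding b by algebra
  then show ?thesis by (rule iffD1[OF mult_left_cancel, rotated]) simp
qed

lemma cubic_wz:
  fixes a b :: real
  assumes "a > 0" "b \<le> a" "a + b > 0"
  shows "cubic_shift a b * cubic_term (a + 3) b k - cubic_term a b k
    = cubic_cert a b (Suc k) - cubic_cert a b k"
proof -
  define d where "d = 1 + (a - b) / 3"
  define e where "e = a + b"
  define x where "x = real k"
  have d: "d > 0" using assms by (simp add: d_def add_pos_nonneg)
  have pos: "a + 4 * x > 0" "d + x > 0" "e + 2 * x > 0" "e + 2 * x + 1 > 0" "e + 2 * x + 2 > 0"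
    "e > 0" "a + 4 * x + 4 > 0" "1 + x > 0"
    using assms d by (auto simp: x_def e_def)
  have pp: "pochhammer a 3 > 0" "pochhammer e 3 > 0"
    using assms by (auto intro!: pochhammer_pos simp: e_def)
  \<comment> \<open>All four terms are rational multiples of \<open>U\<close>, the summand without
    its linear factor, over the common denominator \<open>Q\<close>.\<close>
  define U where "U = cubic_term a b k / (a + 4 * x)"
  define Q where "Q = (d + x) * (e + 2 * x) * (e + 2 * x + 1) * (e + 2 * x + 2)"
  have Q: "Q \<noteq> 0" using pos by (simp add: Q_def)
  have u: "cubic_term a b k = (a + 4 * x) * U" using pos by (simp add: U_def)
  have A: "cubic_shift a b * cubic_term (a + 3) b k
      = (a + 2 * b) / 3 * (a + x) * (a + x + 1) * (a + x + 2) * (a + 3 + 4 * x) / Q * U"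
    unfolding cubic_shift_def cubic_term_shift[OF assms] u d_def[symmetric] e_def[symmetric]
      x_def[symmetric] pochhammer_3[of "a + x"] pochhammer_3[of "e + 2 * x"] Q_def
    using pp pos d by (simp add: divide_simps)
  have B: "cubic_cert a b k = x * (d + x) * (e + 2 * x + 1) * (e + 2 * x + 2) * (9 * x + 6 * a + 3 * b) / Q * U"
    unfolding cubic_cert_def u e_def[symmetric] x_def[symmetric] Q_def
    using pos by (simp add: divide_simps)
  have C: "cubic_cert a b (Suc k) = (a + x) * (b + x) * (1 - b + 2 * x) * (2 - b + 2 * x)
     * (9 * (x + 1) + 6 * a + 3 * b) / (9 * Q) * U"
  proof -
    have s: "real (Suc k) = 1 + x" by (simp add: x_def)
    have l: "e + 2 * (1 + x) = e + 2 * x + 2" "a + 4 * (1 + x) = a + 4 * x + 4" by simp_all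
    show ?thesis
      unfolding cubic_cert_def cubic_term_Suc[OF assms] s u e_def[symmetric] x_def[symmetric] d_def[symmetric] Q_def l
      using pos by (simp add: divide_simps) (simp add: algebra_simps)
  qed
  show ?thesis
    unfolding A B C u
    using arg_cong[OF cubic_cert_identity[of a b x], of "\<lambda>y. y / Q * U"] Q
    unfolding d_def[symmetric] e_def[symmetric] Q_def[symmetric]
    by (simp add: divide_simps) algebra
qed

section \<open>Convergence and the recurrence for the sum\<close>

text \<open>Ratio test: the term ratio tends to 1/9, and 1/2 is a convenient bound above it.\<close>

lemma summable_norm_cubic_term:
  fixes a b :: real
  assumes "a > 0" "b \<le> a" "a + b > 0"
  shows "summable (\<lambda>k. norm (cubic_term a b k))"
proof -
  define r where "r = (\<lambda>k::nat. (a + 4 * real k + 4) * (a + real k) * (b + real k) * (1 - b + 2 * real k) * (2 - b + 2 * real k)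
    / (9 * (a + 4 * real k) * (1 + real k) * (1 + (a - b) / 3 + real k) * (a + b + 2 * real k) * (a + b + 2 * real k + 1)))"
  have "r \<longlonglongrightarrow> 1 / 9"
    unfolding r_def by real_asymp
  then have "eventually (\<lambda>k. \<bar>r k\<bar> < 1 / 2) sequentially"
    by (intro order_tendstoD(2)[OF tendsto_rabs]) auto
  then obtain N where N: "\<And>k. k \<ge> N \<Longrightarrow> \<bar>r k\<bar> < 1 / 2"
    by (auto simp: eventually_sequentially)
  show ?thesis
  proof (rule summable_ratio_test[of "1 / 2" N])
    fix k assume "N \<le> k"
    then have "norm (r k) * norm (cubic_term a b k) \<le> 1 / 2 * norm (cubic_term a b k)"
      using N[of k] by (intro mult_right_mono) auto
    then show "norm (norm (cubic_term a b (Suc k))) \<le> 1 / 2 * norm (norm (cubic_term a b k))"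
      unfolding cubic_term_Suc[OF assms] by (simp add: r_def abs_mult)
  qed simp
qed

text \<open>Summing \<open>cubic_wz\<close> over \<open>k\<close> telescopes. The certificate
  vanishes at \<open>k = 0\<close> through its factor \<open>k\<close>, and at infinity because its
  rational factor tends to 9/8 while the terms tend to 0.\<close>

lemma cubic_suminf_shift:
  fixes a b :: real
  assumes "a > 0" "b \<le> a" "a + b > 0"
  shows "(\<Sum>k. cubic_term a b k) = cubic_shift a b * (\<Sum>k. cubic_term (a + 3) b k)"
proof -
  have s: "summable (cubic_term a b)"
    using summable_norm_cubic_term[OF assms] by (rule summable_norm_cancel)
  have s3: "summable (cubic_term (a + 3) b)"
    using assms by (intro summable_norm_cancel[OF summable_norm_cubic_term]) auto
  have "(\<lambda>k. real k * (9 * real k + 6 * a + 3 * b) / ((a + b + 2 * real k) * (a + 4 * real k))) \<longlonglongrightarrow> 9 / 8"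
    by real_asymp
  from tendsto_mult[OF this summable_LIMSEQ_zero[OF s]]
  have "cubic_cert a b \<longlonglongrightarrow> 0"
    by (simp add: cubic_cert_def[abs_def])
  from telescope_sums[OF this]
  have "(\<lambda>k. cubic_shift a b * cubic_term (a + 3) b k - cubic_term a b k) sums 0"
    by (simp add: cubic_wz[OF assms]) (simp add: cubic_cert_def)
  moreover have "(\<lambda>k. cubic_shift a b * cubic_term (a + 3) b k - cubic_term a b k) sums
      (cubic_shift a b * (\<Sum>k. cubic_term (a + 3) b k) - (\<Sum>k. cubic_term a b k))"
    using s s3 by (intro sums_diff sums_mult summable_sums)
  ultimately show ?thesis
    using sums_unique2 by fastforce
qed

lemma cubic_suminf_shift_iterated:
  fixes a b :: real
  assumes "a > 0" "b \<le> a" "a + b > 0"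
  shows "(\<Sum>k. cubic_term a b k) =
    pochhammer ((a + 2 * b) / 3) n * pochhammer a (3 * n)
    / (pochhammer (1 + (a - b) / 3) n * pochhammer (a + b) (3 * n))
    * (\<Sum>k. cubic_term (a + 3 * real n) b k)"
proof (induction n)
  case (Suc n)
  have p: "pochhammer x (3 * Suc n) = pochhammer x (3 * n) * pochhammer (x + 3 * real n) 3" for x :: real
    using pochhammer_product'[of x "3 * n" 3] by (simp add: add.commute)
  have h: "(\<Sum>k. cubic_term (a + 3 * real n) b k) =
      cubic_shift (a + 3 * real n) b * (\<Sum>k. cubic_term (a + 3 * real (Suc n)) b k)"
    using cubic_suminf_shift[of "a + 3 * real n" b] assms by (simp add: algebra_simps)
  \<comment> \<open>In \<open>n\<close> steps \<open>(a + 2 * b) / 3\<close> and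
    \<open>1 + (a - b) / 3\<close> grow by \<open>n\<close>, but \<open>a\<close> and
    \<open>a + b\<close> by \<open>3 * n\<close>; hence the lengths \<open>n\<close> and
    \<open>3 * n\<close> of the Pochhammer symbols.\<close>
  have q: "cubic_shift (a + 3 * real n) b = ((a + 2 * b) / 3 + real n) * pochhammer (a + 3 * real n) 3
      / ((1 + (a - b) / 3 + real n) * pochhammer (a + b + 3 * real n) 3)"
  proof -
    have "(a + 3 * real n + 2 * b) / 3 = (a + 2 * b) / 3 + real n" "1 + (a + 3 * real n - b) / 3 = 1 + (a - b) / 3 + real n"
      "a + 3 * real n + b = a + b + 3 * real n"
      by (simp_all add: field_simps)
    then show ?thesis unfolding cubic_shift_def by presburger
  qed
  show ?case
    unfolding Suc.IH h q p pochhammer_Suc[of _ n] by (simp add: mult_ac)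
qed simp

section \<open>Behaviour as the shift parameter tends to infinity\<close>

text \<open>After division by the shift parameter every factor of the quotient in
  \<open>cubic_term_shift\<close> is at most 1, and the last one, \<open>d / (d + k)\<close>, is at
  most \<open>d / (d + 1)\<close> because \<open>k\<close> is at least 1. The normalised term at
  \<open>k = 0\<close> is constantly 1.\<close>

lemma cubic_term_shift_le:
  fixes a b :: real
  assumes "a > 0" "b \<le> a" "a + b > 0" "k > 0"
  defines "d \<equiv> 1 + (a - b) / 3"
  shows "\<bar>cubic_term (a + 3) b k\<bar> / (a + 3) \<le> d / (d + 1) * (\<bar>cubic_term a b k\<bar> / a)"
proof -
  define x where "x = real k"
  have x: "x \<ge> 1" using assms by (simp add: x_def)
  have d: "d > 0" using assms by (simp add: d_def add_pos_nonneg)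
  define e where "e = a + b"
  have e: "e > 0" "e \<le> 2 * a" using assms by (simp_all add: e_def)
  \<comment> \<open>With \<open>e\<close> at most \<open>2 * a\<close>, the growth of the upper
    Pochhammer factors is absorbed by that of the lower ones; \<open>i\<close> runs over 0, 1,
    2.\<close>
  have one: "(a + x + i) / (a + i) * ((e + i) / (e + 2 * x + i)) \<le> 1"
    and one0: "(a + x + i) / (a + i) * ((e + i) / (e + 2 * x + i)) \<ge> 0" if "i \<ge> 0" for i
  proof -
    have "x * e \<le> x * (2 * a)" "0 \<le> i * x" using e x that by (auto intro: mult_left_mono)
    then have "(a + x + i) * (e + i) \<le> (a + i) * (e + 2 * x + i)" by (simp add: algebra_simps)
    then show "(a + x + i) / (a + i) * ((e + i) / (e + 2 * x + i)) \<le> 1"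
      using assms e x that by (simp add: divide_simps)
    show "(a + x + i) / (a + i) * ((e + i) / (e + 2 * x + i)) \<ge> 0"
      using assms e x that by simp
  qed
  have lin: "a * (a + 3 + 4 * x) / ((a + 3) * (a + 4 * x)) \<le> 1"
  proof -
    have "a * (a + 3 + 4 * x) \<le> (a + 3) * (a + 4 * x)"
      using x by (simp add: algebra_simps)
    then show ?thesis using assms x by (simp add: divide_le_eq)
  qed
  have lin0: "a * (a + 3 + 4 * x) / ((a + 3) * (a + 4 * x)) \<ge> 0"
    using assms x by simp
  have dd: "d / (d + x) \<le> d / (d + 1)" using d x by (intro divide_left_mono) auto
  define P where "P = (pochhammer (a + x) 3 / pochhammer a 3) * (pochhammer e 3 / pochhammer (e + 2 * x) 3)"
  have P_eq: "P = ((a + x + 0) / (a + 0) * ((e + 0) / (e + 2 * x + 0))) *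
     (((a + x + 1) / (a + 1) * ((e + 1) / (e + 2 * x + 1))) *
     ((a + x + 2) / (a + 2) * ((e + 2) / (e + 2 * x + 2))))"
    by (simp add: P_def pochhammer_3 mult_ac)
  have P: "P \<le> 1" "P \<ge> 0"
    unfolding P_eq by (intro mult_le_one mult_nonneg_nonneg one one0; simp)+
  have "a * (a + 3 + 4 * x) / ((a + 3) * (a + 4 * x)) * P \<le> 1"
    using lin lin0 P by (intro mult_le_one)
  then have "a * (a + 3 + 4 * x) / ((a + 3) * (a + 4 * x)) * P * (d / (d + x)) \<le> 1 * (d / (d + 1))"
    using lin0 P dd d x by (intro mult_mono) auto
  then have main: "a * (a + 3 + 4 * x) / ((a + 3) * (a + 4 * x)) * P * (d / (d + x)) * (\<bar>cubic_term a b k\<bar> / a)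
      \<le> d / (d + 1) * (\<bar>cubic_term a b k\<bar> / a)"
    using assms by (intro mult_right_mono) auto
  have "cubic_term (a + 3) b k = (a + 3 + 4 * x) / (a + 4 * x) * P * (d / (d + x)) * cubic_term a b k"
    using cubic_term_shift[OF assms(1-3), of k] by (simp add: P_def e_def d_def x_def)
  also have "\<bar>\<dots>\<bar> = (a + 3 + 4 * x) / (a + 4 * x) * P * (d / (d + x)) * \<bar>cubic_term a b k\<bar>"
    using P d x assms by (simp add: abs_mult)
  finally have "\<bar>cubic_term (a + 3) b k\<bar>
      = (a + 3 + 4 * x) / (a + 4 * x) * P * (d / (d + x)) * \<bar>cubic_term a b k\<bar>" .
  then have "\<bar>cubic_term (a + 3) b k\<bar> / (a + 3)
      = a * (a + 3 + 4 * x) / ((a + 3) * (a + 4 * x)) * P * (d / (d + x)) * (\<bar>cubic_term a b k\<bar> / a)"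
    using assms(1) by (simp add: mult_ac)
  with main show ?thesis by simp
qed

text \<open>The contraction factors \<open>(d + j) / (d + j + 1)\<close> telescope. The decay is
  only of order 1/n, but uniform in \<open>k\<close>.\<close>

lemma cubic_term_shift_iterated_le:
  fixes a b :: real and n :: nat
  assumes "a > 0" "b \<le> a" "a + b > 0" "k > 0"
  defines "d \<equiv> 1 + (a - b) / 3"
  shows "\<bar>cubic_term (a + 3 * real n) b k\<bar> / (a + 3 * real n) \<le> d / (d + real n) * (\<bar>cubic_term a b k\<bar> / a)"
proof (induction n)
  case 0
  have "d > 0" using assms by (simp add: d_def add_pos_nonneg)
  then show ?case by simp
next
  case (Suc n)
  have d: "d > 0" using assms by (simp add: d_def add_pos_nonneg)
  have *: "1 + (a + 3 * real n - b) / 3 = d + real n" by (simp add: d_def field_simps)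
  have "\<bar>cubic_term (a + 3 * real (Suc n)) b k\<bar> / (a + 3 * real (Suc n))
      \<le> (d + real n) / (d + real n + 1) * (\<bar>cubic_term (a + 3 * real n) b k\<bar> / (a + 3 * real n))"
    using cubic_term_shift_le[of "a + 3 * real n" b k] assms(1-4) unfolding * by (simp add: algebra_simps)
  also have "\<dots> \<le> (d + real n) / (d + real n + 1) * (d / (d + real n) * (\<bar>cubic_term a b k\<bar> / a))"
    using Suc.IH d by (intro mult_left_mono) auto
  also have "\<dots> = d / (d + real (Suc n)) * (\<bar>cubic_term a b k\<bar> / a)"
    using d by (simp add: add_ac)
  finally show ?case .
qed

lemma cubic_suminf_asymp:
  fixes a b :: real
  assumes "a > 0" "b \<le> a" "a + b > 0"
  shows "(\<lambda>n. (\<Sum>k. cubic_term (a + 3 * real n) b k) / (a + 3 * real n)) \<longlonglongrightarrow> 1"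
proof -
  define d where "d = 1 + (a - b) / 3"
  \<comment> \<open>The normalised tail at \<open>n = 0\<close> dominates all later tails, up to the
    factor \<open>d / (d + n)\<close>.\<close>
  define M where "M = (\<Sum>k. \<bar>cubic_term a b (Suc k)\<bar> / a)"
  have sum0: "summable (\<lambda>k. \<bar>cubic_term a b (Suc k)\<bar> / a)"
    using summable_norm_cubic_term[OF assms]
    by (intro summable_divide) (simp only: real_norm_def summable_Suc_iff[of "\<lambda>k. \<bar>cubic_term a b k\<bar>"])
  have bound: "\<bar>(\<Sum>k. cubic_term (a + 3 * real n) b k) / (a + 3 * real n) - 1\<bar> \<le> d / (d + real n) * M" for n
  proof -
    let ?u = "cubic_term (a + 3 * real n) b"
    let ?a = "a + 3 * real n"
    have pos: "?a > 0" using assms by simp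
    have sn: "summable (\<lambda>k. norm (?u k))"
      using assms by (intro summable_norm_cubic_term) auto
    have sS: "summable (\<lambda>k. norm (?u (Suc k)))"
      using sn by (simp add: summable_Suc_iff[of "\<lambda>k. \<bar>?u k\<bar>"])
    have "(\<Sum>k. ?u k) = (\<Sum>k. ?u (Suc k)) + ?u 0"
      using suminf_split_head[OF summable_norm_cancel[OF sn]] by simp
    also have "?u 0 = ?a" by (simp add: cubic_term_def)
    finally have "(\<Sum>k. ?u k) / ?a - 1 = (\<Sum>k. ?u (Suc k)) / ?a"
      using pos by (simp add: field_simps)
    then have "\<bar>(\<Sum>k. ?u k) / ?a - 1\<bar> \<le> (\<Sum>k. \<bar>?u (Suc k)\<bar>) / ?a"
      using summable_norm[OF sS] pos by (simp add: divide_right_mono)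
    also have "\<dots> = (\<Sum>k. \<bar>?u (Suc k)\<bar> / ?a)"
      using sS by (intro suminf_divide[symmetric]) auto
    also have "\<dots> \<le> (\<Sum>k. d / (d + real n) * (\<bar>cubic_term a b (Suc k)\<bar> / a))"
      unfolding d_def using cubic_term_shift_iterated_le[OF assms, of "Suc _" n] sS
      by (intro suminf_le summable_mult[OF sum0] summable_divide) auto
    also have "\<dots> = d / (d + real n) * M"
      unfolding M_def using sum0 by (rule suminf_mult)
    finally show ?thesis .
  qed
  have "(\<lambda>n. d / (d + real n) * M) \<longlonglongrightarrow> 0"
    by real_asymp
  then have "(\<lambda>n. (\<Sum>k. cubic_term (a + 3 * real n) b k) / (a + 3 * real n) - 1) \<longlonglongrightarrow> 0"
    by (rule Lim_null_comparison[OF always_eventually, rotated]) (use bound in simp)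
  then show ?thesis by (simp add: LIM_zero_iff)
qed

section \<open>Closed form via Euler's limit for 1/Gamma\<close>

text \<open>Euler's approximant solved for the Pochhammer symbol. It has \<open>n + 1\<close>
  factors, which is where the extra linear factors \<open>z + n\<close> come from when
  \<open>pochhammer z n\<close> is needed.\<close>

lemma pochhammer_Suc_eq_rGamma_series:
  fixes x :: real
  assumes "n > 0"
  shows "pochhammer x (Suc n) = rGamma_series x n * fact n * real n powr x"
  using assms by (simp add: rGamma_series_def powr_def)

text \<open>The form with \<open>rGamma\<close> also covers \<open>(a + 2 * b) / 3\<close> being a
  nonpositive integer, where the sum is 0.\<close>

lemma cubic_summation:
  fixes a b :: real
  assumes "a > 0" "b \<le> a" "a + b > 0"
  shows "(\<Sum>k. cubic_term a b k) =
    3 powr (1 - b) * Gamma (1 + (a - b) / 3) * Gamma (a + b) * rGamma ((a + 2 * b) / 3) / Gamma a"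
proof -
  define d where "d = 1 + (a - b) / 3"
  define x where "x = (a + 2 * b) / 3"
  define e where "e = a + b"
  have pos: "d > 0" "e > 0" using assms by (simp_all add: d_def e_def add_pos_nonneg)
  define c where "c = (\<lambda>n. pochhammer x n * pochhammer a (3 * n) / (pochhammer d n * pochhammer e (3 * n)))"
  \<comment> \<open>\<open>c\<close> is the accumulated product of shift factors and
    \<open>R\<close> its Gamma part. In \<open>c\<close> the factorials cancel, and since
    \<open>x - d = b - 1\<close> and \<open>a - e = - b\<close>, the powers reduce to
    \<open>3 powr (- b) / n\<close>. The 1/n is balanced by the growth of the sum.\<close>
  define R where "R = (\<lambda>n. rGamma_series x n / rGamma_series d n
    * (rGamma_series a (3 * n) / rGamma_series e (3 * n)))"
  have nz: "rGamma z \<noteq> 0" if "z > 0" for z :: real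
    using that by (auto simp: rGamma_eq_zero_iff elim!: nonpos_Ints_cases)
  have "(\<lambda>n. rGamma_series z (3 * n)) \<longlonglongrightarrow> rGamma z" for z :: real
    using LIMSEQ_subseq_LIMSEQ[OF rGamma_series_LIMSEQ, of "\<lambda>n. 3 * n" z]
    by (simp add: strict_mono_def o_def)
  then have "R \<longlonglongrightarrow> rGamma x / rGamma d * (rGamma a / rGamma e)"
    unfolding R_def using pos nz by (intro tendsto_intros) auto
  moreover have "(\<lambda>n. 3 powr (- b) * ((d + real n) / (x + real n) * ((e + 3 * real n) / real n)))
      \<longlonglongrightarrow> 3 powr (- b) * 3"
    by (intro tendsto_intros; real_asymp)
  ultimately have "(\<lambda>n. R n * (3 powr (- b) * ((d + real n) / (x + real n) * ((e + 3 * real n) / real n))))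
      \<longlonglongrightarrow> rGamma x / rGamma d * (rGamma a / rGamma e) * (3 powr (- b) * 3)"
    by (rule tendsto_mult)
  moreover have "eventually (\<lambda>n. R n * (3 powr (- b) * ((d + real n) / (x + real n) * ((e + 3 * real n) / real n)))
      = c n * (a + 3 * real n)) sequentially"
  proof -
    \<comment> \<open>\<open>x\<close> may be negative, so \<open>x + n\<close> is positive only for
      large \<open>n\<close>.\<close>
    have "eventually (\<lambda>n. real n > max 0 (- x)) sequentially"
      using filterlim_real_sequentially unfolding filterlim_at_top_dense by blast
    then show ?thesis
    proof eventually_elim
      case (elim n)
      then have n: "n > 0" "x + real n > 0" by auto
      have P: "pochhammer z n = rGamma_series z n * fact n * real n powr z / (z + real n)"
        if "z + real n > 0" for z
        using that pochhammer_Suc_eq_rGamma_series[of n z] n by (simp add: pochhammer_Suc field_simps)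
      have P3: "pochhammer z (3 * n)
          = rGamma_series z (3 * n) * fact (3 * n) * (3 * real n) powr z / (z + 3 * real n)"
        if "z > 0" for z
      proof -
        have "z + 3 * real n > 0" using that by simp
        then show ?thesis
          using pochhammer_Suc_eq_rGamma_series[of "3 * n" z] n
          by (simp add: pochhammer_Suc field_simps)
      qed
      have "pochhammer z n > 0" "pochhammer z (3 * n) > 0" if "z > 0" for z :: real
        using that by (auto intro: pochhammer_pos)
      then have S: "rGamma_series d n \<noteq> 0" "rGamma_series e (3 * n) \<noteq> 0"
        using P[of d] P3[of e] pos n by (metis add_pos_pos mult_zero_left div_0 less_irrefl of_nat_0_less_iff)+
      have xd: "x = d + b - 1" by (simp add: x_def d_def field_simps)
      have pw1: "real n powr x = real n powr d * real n powr b / real n"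
        using n unfolding xd by (simp add: powr_diff powr_add)
      have pw2: "(3 * real n) powr e = (3 * real n) powr a * (3 powr b * real n powr b)"
        using n by (simp add: e_def powr_add powr_mult)
      have npos: "d + real n > 0" "e + 3 * real n > 0" "a + 3 * real n > 0"
        using pos assms by simp_all
      show ?case
        unfolding c_def R_def P[OF n(2)] P[OF npos(1)] P3[OF assms(1)] P3[OF pos(2)] pw1 pw2
        using n S npos by (simp add: powr_minus divide_simps)
    qed
  qed
  ultimately have "(\<lambda>n. c n * (a + 3 * real n))
      \<longlonglongrightarrow> rGamma x / rGamma d * (rGamma a / rGamma e) * (3 powr (- b) * 3)"
    by (rule Lim_transform_eventually)
  from tendsto_mult[OF this cubic_suminf_asymp[OF assms]]
  have "(\<lambda>n. c n * (a + 3 * real n) * ((\<Sum>k. cubic_term (a + 3 * real n) b k) / (a + 3 * real n)))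
      \<longlonglongrightarrow> rGamma x / rGamma d * (rGamma a / rGamma e) * (3 powr (- b) * 3)"
    by simp
  \<comment> \<open>By the iterated recurrence this convergent sequence is constant, so its limit is
    the sum itself.\<close>
  moreover have "c n * (a + 3 * real n) * ((\<Sum>k. cubic_term (a + 3 * real n) b k) / (a + 3 * real n))
      = (\<Sum>k. cubic_term a b k)" for n
  proof -
    have "a + 3 * real n > 0" using assms by simp
    then show ?thesis
      using cubic_suminf_shift_iterated[OF assms, of n] by (simp add: c_def d_def x_def e_def)
  qed
  ultimately have "(\<Sum>k. cubic_term a b k) = rGamma x / rGamma d * (rGamma a / rGamma e) * (3 powr (- b) * 3)"
    by (simp add: LIMSEQ_const_iff)
  also have "\<dots> = 3 powr (1 - b) * Gamma d * Gamma e * rGamma x / Gamma a"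
    by (simp add: rGamma_inverse_Gamma powr_diff powr_minus field_simps)
  finally show ?thesis by (simp add: d_def e_def x_def)
qed

section \<open>Gamma at half-integers\<close>

lemma shifted_factorial_of_real:
  "shifted_factorial (of_real x) n = of_real (Gamma (x + of_int n) / Gamma x)"
  unfolding shifted_factorial_def
  by (simp flip: Gamma_complex_of_real)

lemma half_odd_notin_nonpos_Ints:
  "(of_int (2 * m + 1) / 2 :: real) \<notin> \<int>\<^sub>\<le>\<^sub>0"
proof
  assume "(of_int (2 * m + 1) / 2 :: real) \<in> \<int>\<^sub>\<le>\<^sub>0"
  then obtain n where "(of_int (2 * m + 1) / 2 :: real) = of_int n"
    by (auto elim: nonpos_Ints_cases)
  then have "(of_int (2 * m + 1) :: real) = of_int (2 * n)" by simp
  then have "2 * m + 1 = 2 * n" by (simp only: of_int_eq_iff)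
  then show False by presburger
qed

lemma Gamma_add_of_nat:
  fixes x :: real
  assumes "x \<notin> \<int>\<^sub>\<le>\<^sub>0"
  shows "Gamma (x + of_nat n) = Gamma x * pochhammer x n"
  using assms by (simp add: pochhammer_Gamma Gamma_eq_zero_iff)

lemma Gamma_five_halves: "Gamma (5 / 2 :: real) = 3 / 4 * sqrt pi"
  using Gamma_plus1[of "1 / 2 :: real"] Gamma_plus1[of "3 / 2 :: real"] Gamma_one_half_real
  by (simp add: half_odd_notin_nonpos_Ints[of 0, simplified] half_odd_notin_nonpos_Ints[of 1, simplified])

lemma Gamma_minus_three_halves: "Gamma (-(3 / 2) :: real) = 4 / 3 * sqrt pi"
  using Gamma_plus1[of "-(1 / 2) :: real"] Gamma_plus1[of "-(3 / 2) :: real"] Gamma_one_half_real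
    half_odd_notin_nonpos_Ints[of "-1"] half_odd_notin_nonpos_Ints[of "-2"]
  by simp

lemma Gamma_reflection_real:
  fixes z :: real
  shows "Gamma z * Gamma (1 - z) = pi / sin (pi * z)"
proof -
  have "complex_of_real (Gamma z * Gamma (1 - z)) = of_real (pi / sin (pi * z))"
    using Gamma_reflection_complex[of "of_real z"]
    by (simp flip: Gamma_complex_of_real sin_of_real)
  then show ?thesis by (simp only: of_real_eq_iff)
qed

section \<open>Specialisation to the integer parameters\<close>

theorem theorem7:
  fixes p q :: int
  assumes "min (p + q + 1) (p - q) \<ge> 0"
  shows "summable (series_term p q) \<and>
    8 * (-1) powi q / (3 powr (3 * of_int q + 5/2) * of_real pi)
      = shifted_factorial (1/2) (p + 2*q + 2) * (\<Sum>k. series_term p q k)"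
proof -
  \<comment> \<open>With these values the numerator involves Gamma at \<open>a + k\<close>,
    \<open>b + k\<close> and \<open>1 - b + 2 * k\<close>, since
    \<open>-3/2 - 3 * q = 1 - b\<close>.\<close>
  define a b :: real where "a = 5 / 2 + 3 * p" and "b = 5 / 2 + 3 * q"
  \<comment> \<open>The constant offsets of the two factorials; they give the lower parameters
    \<open>1 + m\<close> and \<open>1 + r\<close>.\<close>
  define m r where "m = nat (p - q)" and "r = nat (3 * p + 3 * q + 4)"
  have pq: "p + q + 1 \<ge> 0" "p - q \<ge> 0" using assms by auto
  \<comment> \<open>Adding the two inequalities gives \<open>2 * p + 1 \<ge> 0\<close>.\<close>
  then have p0: "p \<ge> 0" by linarith
  have m: "of_int (p - q) = real m" "int m = p - q" using pq by (simp_all add: m_def)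
  have r: "of_int (3 * p + 3 * q + 4) = real r" "int r = 3 * p + 3 * q + 4" using pq by (simp_all add: r_def)
  have ab: "a > 0" "b \<le> a" "a + b > 0"
    using p0 pq r(1) unfolding a_def b_def by simp_all
  have d: "1 + (a - b) / 3 = 1 + real m" using m(1) by (simp add: a_def b_def field_simps)
  have e: "a + b = 1 + real r" using r(1) by (simp add: a_def b_def)
  have aN: "a \<notin> \<int>\<^sub>\<le>\<^sub>0" using half_odd_notin_nonpos_Ints[of "3 * p + 2"] by (simp add: a_def field_simps)
  have bN: "b \<notin> \<int>\<^sub>\<le>\<^sub>0" using half_odd_notin_nonpos_Ints[of "3 * q + 2"] by (simp add: b_def field_simps)
  have bN': "1 - b \<notin> \<int>\<^sub>\<le>\<^sub>0" using half_odd_notin_nonpos_Ints[of "- 3 * q - 2"] by (simp add: b_def field_simps)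
  \<comment> \<open>This is \<open>1/2 + (p + 2 * q + 2)\<close>, so the prefactor of the series
    carries exactly the Gamma value that cancels the \<open>rGamma\<close> of the closed
    form.\<close>
  have x: "(a + 2 * b) / 3 = of_int (2 * (p + 2 * q + 2) + 1) / 2"
    by (simp add: a_def b_def field_simps)
  have xN: "(a + 2 * b) / 3 \<notin> \<int>\<^sub>\<le>\<^sub>0"
    unfolding x by (rule half_odd_notin_nonpos_Ints)
  \<comment> \<open>The leading 2 comes from
    \<open>8 * k + 6 * p + 5 = 2 * (a + 4 * k)\<close>.\<close>
  define C where "C = 2 * Gamma a * Gamma b * Gamma (1 - b) / (Gamma (5 / 2) ^ 2 * Gamma (-(3 / 2)) * fact m * fact r)"
  have factN: "fact (n + k) = (fact n * pochhammer (1 + real n) k :: real)" for n k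
    by (simp add: pochhammer_fact pochhammer_product')
  have series_term: "series_term p q k = of_real (C * cubic_term a b k)" for k
  proof -
    have 1: "nat (int k + p - q) = m + k" "nat (2 * int k + 3 * p + 3 * q + 4) = r + 2 * k"
      using m r by linarith+
    have 2: "shifted_factorial (5 / 2) (int k + 3 * p) = of_real (Gamma a * pochhammer a k / Gamma (5 / 2))"
      using shifted_factorial_of_real[of "5 / 2" "int k + 3 * p"] Gamma_add_of_nat[OF aN, of k]
      by (simp add: a_def add_ac)
    have 3: "shifted_factorial (5 / 2) (int k + 3 * q) = of_real (Gamma b * pochhammer b k / Gamma (5 / 2))"
      using shifted_factorial_of_real[of "5 / 2" "int k + 3 * q"] Gamma_add_of_nat[OF bN, of k]
      by (simp add: b_def add_ac)
    have "-(3 / 2) + real_of_int (2 * int k - 3 * q) = 1 - b + of_nat (2 * k)" by (simp add: b_def)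
    with shifted_factorial_of_real[of "-(3 / 2)" "2 * int k - 3 * q"] Gamma_add_of_nat[OF bN', of "2 * k"]
    have "shifted_factorial (of_real (-(3 / 2))) (2 * int k - 3 * q)
        = of_real (Gamma (1 - b) * pochhammer (1 - b) (2 * k) / Gamma (-(3 / 2)))"
      by (simp only:)
    then have 4: "shifted_factorial (-(3 / 2)) (2 * int k - 3 * q)
        = of_real (Gamma (1 - b) * pochhammer (1 - b) (2 * k) / Gamma (-(3 / 2)))"
      by simp
    have 5: "of_int (8 * int k + 6 * p + 5) = complex_of_real (2 * (a + 4 * k))"
      by (simp add: a_def)
    have 6: "fact (m + k) = complex_of_real (fact m * pochhammer (1 + real m) k)"
      "fact (r + 2 * k) = complex_of_real (fact r * pochhammer (1 + real r) (2 * k))"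
      by (simp_all only: factN[symmetric] of_real_fact)
    have 7: "fact k = complex_of_real (fact k)" "9 ^ k = complex_of_real (9 ^ k)" by simp_all
    show ?thesis
      unfolding series_term_def 1 2 3 4 5 6 7 of_real_mult[symmetric] of_real_divide[symmetric]
        of_real_eq_iff cubic_term_def C_def d e
      by (simp add: power2_eq_square mult_ac del: distrib_left_numeral)
  qed
  have s: "summable (cubic_term a b)"
    using summable_norm_cubic_term[OF ab] by (rule summable_norm_cancel)
  have "series_term p q sums of_real (C * (\<Sum>k. cubic_term a b k))"
    unfolding series_term[abs_def] using s by (intro sums_of_real sums_mult summable_sums)
  then have sums: "summable (series_term p q)"
      "(\<Sum>k. series_term p q k) = of_real (C * (\<Sum>k. cubic_term a b k))"
    by (auto simp: sums_iff)
  \<comment> \<open>Since \<open>b = 1/2 + (3 * q + 2)\<close>, the sine is a sign whose parity is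
    that of \<open>3 * q + 2\<close>, hence of \<open>q\<close>.\<close>
  have "sin (pi * b) = sin (pi / 2 + pi * of_int (3 * q + 2))"
    by (simp add: b_def field_simps)
  also have "\<dots> = cos (pi * of_int (3 * q + 2))"
    by (simp add: sin_add)
  also have "\<dots> = (-1) powi q"
    by (simp only: cos_npi_int) (simp add: power_int_minus_left)
  finally have "sin (pi * b) = (-1) powi q" .
  then have refl: "Gamma b * Gamma (1 - b) = pi * (-1) powi q"
    using Gamma_reflection_real[of b] by (simp add: power_int_minus_left split: if_splits)
  have "8 * (-1) powi q / (3 powr (3 * of_int q + 5 / 2) * pi)
      = Gamma ((a + 2 * b) / 3) / Gamma (1 / 2) * (C * (\<Sum>k. cubic_term a b k))"
  proof -
    have A: "Gamma ((a + 2 * b) / 3) * rGamma ((a + 2 * b) / 3) = 1"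
      using xN by (simp add: rGamma_inverse_Gamma Gamma_eq_zero_iff)
    have B: "Gamma a \<noteq> 0" using aN by (simp add: Gamma_eq_zero_iff)
    have F: "Gamma (1 + real m) = fact m" "Gamma (1 + real r) = fact r"
      by (simp_all add: Gamma_fact)
    have P: "3 powr (1 - b) = 3 / 3 powr (3 * of_int q + 5 / 2)"
      by (simp only: powr_diff) (simp add: b_def add.commute)
    have G: "Gamma (1 / 2) * (Gamma (5 / 2) ^ 2 * Gamma (-(3 / 2))) = 3 / 4 * pi ^ 2"
      by (simp add: Gamma_five_halves Gamma_minus_three_halves Gamma_one_half_real
          power_mult_distrib power2_eq_square)
    \<comment> \<open>The factorials and \<open>Gamma a\<close> cancel. What remains is
      \<open>2 * pi * (-1) powi q\<close> from reflection, divided by \<open>3 / 4 * pi ^ 2\<close>,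
      times 3 over the power of 3.\<close>
    have "Gamma ((a + 2 * b) / 3) / Gamma (1 / 2) * (C * (\<Sum>k. cubic_term a b k))
      = 2 * (Gamma b * Gamma (1 - b)) / (Gamma (1 / 2) * (Gamma (5 / 2) ^ 2 * Gamma (-(3 / 2))))
        * 3 powr (1 - b) * (Gamma ((a + 2 * b) / 3) * rGamma ((a + 2 * b) / 3))"
      unfolding cubic_summation[OF ab] d e F C_def using B by (simp add: mult_ac)
    also have "\<dots> = 8 * (-1) powi q / (3 powr (3 * of_int q + 5 / 2) * pi)"
      unfolding A G P refl by (simp add: power2_eq_square)
    finally show ?thesis ..
  qed
  then have "complex_of_real (8 * (-1) powi q / (3 powr (3 * of_int q + 5 / 2) * pi))
      = of_real (Gamma ((a + 2 * b) / 3) / Gamma (1 / 2)) * (\<Sum>k. series_term p q k)"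
    unfolding sums(2) by (simp only: of_real_mult)
  moreover have "complex_of_real (Gamma ((a + 2 * b) / 3) / Gamma (1 / 2)) = shifted_factorial (1 / 2) (p + 2 * q + 2)"
    using shifted_factorial_of_real[of "1 / 2" "p + 2 * q + 2"] unfolding x by (simp add: field_simps)
  moreover have "complex_of_real (8 * (-1) powi q / (3 powr (3 * of_int q + 5 / 2) * pi))
      = 8 * (-1) powi q / (3 powr (3 * of_int q + 5 / 2) * of_real pi)"
    using powr_of_real[of 3 "3 * of_int q + 5 / 2"] by simp
  ultimately show ?thesis using sums(1) by (simp only: simp_thms)
qed

end
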